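(* Let $G$ be a connected graph of order $n\ge 5$, and let $\emptyset\neq D\subseteq E(G)$. Then $\bar N_L$ is an interference of $D$ if and only if, for every edge $e\notin D$ that is adjacent to all edges in $D$, there exists an edge $f\neq e$, not adjacent to $e$, such that $D$ is not composed solely of edges with one end vertex in $V(e)$ and the other in $V(f)$.
   Context: All graphs are finite and simple. Two distinct edges are adjacent if they share an endpoint; $V(e)$ is the set of the two endpoints of the edge $e$. For $e\in E(G)$, $N_L(e)$ is the set of edges of $G$ adjacent to $e$ (its open neighborhood in the line graph $L(G)$), and $\bar N_L(e)=E(G)\setminus N_L(e)$. $\bar N_L: E(G)\to 2^{E(G)}$ is an interference of $D$ (with respect to the complete graph on $E(G)$) if $\bar N_L$ is injective, $\bar N_L(e)\ne\emptyset$ for all $e\in E(G)$, and for every $e\in E(G)\setminus D$ there is $d\in D$ with $\bar N_L(e)\cap\bar N_L(d)\neq\emptyset$. *)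

theory Defs
  imports Main
begin

text \<open>A graph is given by its vertex set V and its edge set E, an edge being the two-element
  set of its endpoints; thus the set V(e) of endpoints of an edge e is e itself.\<close>

definition finite_simple_graph :: "'a set \<Rightarrow> 'a set set \<Rightarrow> bool" where
  "finite_simple_graph V E \<longleftrightarrow> finite V \<and> (\<forall>e\<in>E. e \<subseteq> V \<and> card e = 2)"

definition connected_graph :: "'a set \<Rightarrow> 'a set set \<Rightarrow> bool" where
  "connected_graph V E \<longleftrightarrow> V \<noteq> {} \<and> (\<forall>u\<in>V. \<forall>v\<in>V. (u, v) \<in> {(x, y). {x, y} \<in> E}\<^sup>*)"

definition adjacent_edges :: "'a set \<Rightarrow> 'a set \<Rightarrow> bool" where
  "adjacent_edges e f \<longleftrightarrow> e \<noteq> f \<and> e \<inter> f \<noteq> {}"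

definition edge_nbhd :: "'a set set \<Rightarrow> 'a set \<Rightarrow> 'a set set" where
  "edge_nbhd E e = {f \<in> E. adjacent_edges e f}"

text \<open>The complement is that of the open neighbourhood, so an edge e belongs to its own
  \<open>edge_conbhd E e\<close>.\<close>

definition edge_conbhd :: "'a set set \<Rightarrow> 'a set \<Rightarrow> 'a set set" where
  "edge_conbhd E e = E - edge_nbhd E e"

text \<open>Interference of D with respect to the complete graph on X: as any two distinct elements of
  X are adjacent there, no adjacency between x and d has to be required.\<close>

definition interference :: "'b set \<Rightarrow> ('b \<Rightarrow> 'b set) \<Rightarrow> 'b set \<Rightarrow> bool" where
  "interference X F D \<longleftrightarrow>
     F ` X \<subseteq> Pow X \<and>
     inj_on F X \<and>
     (\<forall>x\<in>X. F x \<noteq> {}) \<and>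
     (\<forall>x\<in>X - D. \<exists>d\<in>D. F x \<inter> F d \<noteq> {})"

definition edge_between :: "'a set \<Rightarrow> 'a set \<Rightarrow> 'a set \<Rightarrow> bool" where
  "edge_between A B d \<longleftrightarrow> (\<exists>u\<in>A. \<exists>v\<in>B. d = {u, v})"

end

theory Submission
  imports Defs
begin

text \<open>Of the requirements on an interference, only the last one depends on \<open>D\<close>.

  Each co-neighbourhood contains its own edge, hence is nonempty. Injectivity is where connectedness
  and the order of the graph enter. If two distinct edges \<open>e\<close> and \<open>f\<close> had the same neighbours in the
  line graph, they would be disjoint, for otherwise \<open>f\<close> would be its own neighbour. Since
  \<open>e \<union> f\<close> has only four vertices, some edge of the connected graph leaves it, and that edge is
  adjacent to exactly one of \<open>e\<close> and \<open>f\<close> (lemma \<open>inj_on_edge_conbhd\<close>).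

  In the last requirement an edge \<open>e\<close> outside \<open>D\<close> that is not adjacent to some \<open>d \<in> D\<close> is harmless,
  since \<open>d\<close> itself lies in both co-neighbourhoods. If \<open>e\<close> is adjacent to all of \<open>D\<close>, a common element
  \<open>f\<close> of the co-neighbourhoods of \<open>e\<close> and \<open>d\<close> is an edge disjoint from \<open>e\<close> and not adjacent to \<open>d\<close>.
  As \<open>d\<close> has one endpoint in \<open>e\<close>, the latter means that \<open>d\<close> does not join \<open>e\<close> to \<open>f\<close>
  (lemma \<open>adjacent_edges_iff_edge_between\<close>).\<close>

lemma adjacent_edges_commute: "adjacent_edges e f \<longleftrightarrow> adjacent_edges f e"
  by (auto simp: adjacent_edges_def)

lemma mem_edge_conbhd_iff: "f \<in> edge_conbhd E e \<longleftrightarrow> f \<in> E \<and> \<not> adjacent_edges e f"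
  by (auto simp: edge_conbhd_def edge_nbhd_def)

lemma self_mem_edge_conbhd: "e \<in> E \<Longrightarrow> e \<in> edge_conbhd E e"
  by (simp add: mem_edge_conbhd_iff adjacent_edges_def)

text \<open>A path from inside \<open>W\<close> to the outside has a first step that leaves \<open>W\<close>.\<close>

lemma connected_graph_crossing_edge:
  assumes "connected_graph V E" and "w \<in> V" "w \<in> W" and "z \<in> V" "z \<notin> W"
  obtains x y where "{x, y} \<in> E" "x \<in> W" "y \<notin> W"
proof -
  have "(w, z) \<in> {(x, y). {x, y} \<in> E}\<^sup>*"
    using assms by (auto simp: connected_graph_def)
  then have "z \<notin> W \<longrightarrow> (\<exists>x y. {x, y} \<in> E \<and> x \<in> W \<and> y \<notin> W)"
    using \<open>w \<in> W\<close> by (induction rule: rtrancl_induct) auto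
  with \<open>z \<notin> W\<close> that show thesis by blast
qed

text \<open>The bound on the order is sharp: in a cycle of length four, opposite edges have the same
  neighbours.\<close>

lemma inj_on_edge_conbhd:
  assumes graph: "finite_simple_graph V E" and conn: "connected_graph V E" and order: "card V \<ge> 5"
  shows "inj_on (edge_conbhd E) E"
proof (rule inj_onI, rule ccontr)
  fix e f
  assume e: "e \<in> E" and f: "f \<in> E" and eq: "edge_conbhd E e = edge_conbhd E f" and "e \<noteq> f"
  have same: "adjacent_edges e g \<longleftrightarrow> adjacent_edges f g" if "g \<in> E" for g
    using eq that by (metis mem_edge_conbhd_iff)
  have disj: "e \<inter> f = {}"
    using same[OF f] \<open>e \<noteq> f\<close> by (auto simp: adjacent_edges_def)
  have size: "e \<subseteq> V" "card e = 2" "card f = 2"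
    using graph e f by (auto simp: finite_simple_graph_def)
  have "card (e \<union> f) \<le> 4"
    using card_Un_le[of e f] size by simp
  moreover have "finite (e \<union> f)"
    using size by (metis card.infinite finite_Un zero_neq_numeral)
  ultimately have "\<not> V \<subseteq> e \<union> f"
    using order card_mono[of "e \<union> f" V] by linarith
  then obtain z where z: "z \<in> V" "z \<notin> e \<union> f" by blast
  obtain w where w: "w \<in> e" using size by fastforce
  obtain x y where xy: "{x, y} \<in> E" "x \<in> e \<union> f" "y \<notin> e \<union> f"
    using connected_graph_crossing_edge[OF conn, of w "e \<union> f" z] w z size by blast
  then have "adjacent_edges e {x, y} \<longleftrightarrow> x \<in> e" "adjacent_edges f {x, y} \<longleftrightarrow> x \<in> f"
    by (auto simp: adjacent_edges_def)
  with same[OF xy(1)] xy(2) disj show False by blast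
qed

text \<open>An edge that meets each of two disjoint sets has exactly one endpoint in each.\<close>

lemma adjacent_edges_iff_edge_between:
  assumes "card d = 2" and adj: "adjacent_edges e d" and disj: "e \<inter> f = {}"
  shows "adjacent_edges d f \<longleftrightarrow> edge_between e f d"
proof
  assume "adjacent_edges d f"
  then obtain u v where uv: "u \<in> e" "u \<in> d" "v \<in> f" "v \<in> d"
    using adj by (auto simp: adjacent_edges_def)
  with disj have "u \<noteq> v" by blast
  with \<open>card d = 2\<close> uv have "d = {u, v}"
    by (auto simp: card_2_iff)
  with uv show "edge_between e f d"
    by (auto simp: edge_between_def)
next
  assume "edge_between e f d"
  with disj show "adjacent_edges d f"
    by (auto simp: adjacent_edges_def edge_between_def)
qed

lemma conbhds_meet_iff:
  assumes "\<forall>g\<in>E. card g = 2" and "d \<in> E" and adj: "adjacent_edges e d"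
  shows "edge_conbhd E e \<inter> edge_conbhd E d \<noteq> {} \<longleftrightarrow>
    (\<exists>f\<in>E. f \<noteq> e \<and> \<not> adjacent_edges e f \<and> \<not> edge_between e f d)"
proof -
  (* The edge e is no common element, being adjacent to d; any other non-neighbour of e is
     disjoint from e. *)
  have "f \<in> edge_conbhd E e \<inter> edge_conbhd E d \<longleftrightarrow>
      f \<noteq> e \<and> \<not> adjacent_edges e f \<and> \<not> edge_between e f d" if "f \<in> E" for f
  proof (cases "f = e \<or> adjacent_edges e f")
    case True
    then show ?thesis
      using adj adjacent_edges_commute[of e d] by (auto simp: mem_edge_conbhd_iff)
  next
    case False
    then have "e \<inter> f = {}" by (auto simp: adjacent_edges_def)
    then have "adjacent_edges d f \<longleftrightarrow> edge_between e f d"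
      using assms by (intro adjacent_edges_iff_edge_between) auto
    with False that show ?thesis by (auto simp: mem_edge_conbhd_iff)
  qed
  moreover have "edge_conbhd E e \<subseteq> E" by (auto simp: edge_conbhd_def)
  ultimately show ?thesis by blast
qed

theorem corollary4p23:
  fixes V :: "'a set" and E D :: "'a set set"
  assumes "finite_simple_graph V E"
    and "connected_graph V E"
    and "card V \<ge> 5"
    and "D \<noteq> {}" and "D \<subseteq> E"
  shows "interference E (edge_conbhd E) D \<longleftrightarrow>
    (\<forall>e\<in>E - D. (\<forall>d\<in>D. adjacent_edges e d) \<longrightarrow>
      (\<exists>f\<in>E. f \<noteq> e \<and> \<not> adjacent_edges e f \<and> \<not> (\<forall>d\<in>D. edge_between e f d)))"
proof -
  have two: "\<forall>g\<in>E. card g = 2"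
    using assms(1) by (simp add: finite_simple_graph_def)
  have "edge_conbhd E ` E \<subseteq> Pow E" by (auto simp: edge_conbhd_def)
  moreover have "\<forall>e\<in>E. edge_conbhd E e \<noteq> {}" using self_mem_edge_conbhd by blast
  ultimately have "interference E (edge_conbhd E) D \<longleftrightarrow>
      (\<forall>e\<in>E - D. \<exists>d\<in>D. edge_conbhd E e \<inter> edge_conbhd E d \<noteq> {})"
    using inj_on_edge_conbhd[OF assms(1-3)] by (simp add: interference_def)
  also have "\<dots> \<longleftrightarrow>
      (\<forall>e\<in>E - D. (\<forall>d\<in>D. adjacent_edges e d) \<longrightarrow>
        (\<exists>f\<in>E. f \<noteq> e \<and> \<not> adjacent_edges e f \<and> \<not> (\<forall>d\<in>D. edge_between e f d)))"
  proof (rule ball_cong[OF refl])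
    fix e assume "e \<in> E - D"
    show "(\<exists>d\<in>D. edge_conbhd E e \<inter> edge_conbhd E d \<noteq> {}) \<longleftrightarrow>
      ((\<forall>d\<in>D. adjacent_edges e d) \<longrightarrow>
        (\<exists>f\<in>E. f \<noteq> e \<and> \<not> adjacent_edges e f \<and> \<not> (\<forall>d\<in>D. edge_between e f d)))"
    proof (cases "\<forall>d\<in>D. adjacent_edges e d")
      case True
      then have "edge_conbhd E e \<inter> edge_conbhd E d \<noteq> {} \<longleftrightarrow>
          (\<exists>f\<in>E. f \<noteq> e \<and> \<not> adjacent_edges e f \<and> \<not> edge_between e f d)" if "d \<in> D" for d
        using that assms(5) by (intro conbhds_meet_iff[OF two]) auto
      then have "(\<exists>d\<in>D. edge_conbhd E e \<inter> edge_conbhd E d \<noteq> {}) \<longleftrightarrow>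
          (\<exists>d\<in>D. \<exists>f\<in>E. f \<noteq> e \<and> \<not> adjacent_edges e f \<and> \<not> edge_between e f d)"
        by (rule bex_cong[OF refl])
      also have "\<dots> \<longleftrightarrow>
          (\<exists>f\<in>E. f \<noteq> e \<and> \<not> adjacent_edges e f \<and> \<not> (\<forall>d\<in>D. edge_between e f d))"
        by blast
      finally show ?thesis using True by argo
    next
      case False
      then obtain d where "d \<in> D" "\<not> adjacent_edges e d" by blast
      then have "d \<in> edge_conbhd E e \<inter> edge_conbhd E d"
        using assms(5) self_mem_edge_conbhd[of d E] by (auto simp: mem_edge_conbhd_iff)
      with \<open>d \<in> D\<close> have "\<exists>d\<in>D. edge_conbhd E e \<inter> edge_conbhd E d \<noteq> {}" by blast
      with False show ?thesis by (simp only: simp_thms)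
    qed
  qed
  finally show ?thesis .
qed

end
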